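(* Let $s\in\mathbb{C}$. As operators (acting on functions $f:(0,1]\to\mathbb{C}$ for which all series involved converge absolutely), \[ (\mathcal{V}_s-\mathcal{I})\,\mathcal{U}_s=\mathcal{V}_s\,(\mathcal{B}_s-\mathcal{I}), \] where $\mathcal{I}$ is the identity operator.
   Context: For $s\in\mathbb{C}$, real $y>0$ ($y^{-s}=e^{-s\ln y}$) and $f:(0,1]\to\mathbb{C}$, $x\in(0,1]$, define \[ \mathcal{V}_s[f](x)=\sum_{k\ge1}\ \sum_{\substack{a\ \text{odd}\\ 0<a<2^k}}\Big(\frac{1}{a+2^kx}\Big)^{s} f\Big(\frac{1}{a+2^kx}\Big),\qquad \mathcal{U}_s[f](x)=\sum_{k\ge1}\Big(\frac{1}{1+2^kx}\Big)^{s} f\Big(\frac{1}{1+2^kx}\Big), \] \[ \widetilde{\mathcal{U}}_s[f](x)=\Big(\frac1x\Big)^{s}\,\mathcal{U}_s[f]\Big(\frac1x\Big)=\sum_{k\ge1}\Big(\frac{1}{x+2^k}\Big)^{s} f\Big(\frac{x}{x+2^k}\Big), \] and the binary Euclidean operator $\mathcal{B}_s=\mathcal{U}_s+\widetilde{\mathcal{U}}_s$, i.e. \[ \mathcal{B}_s[f](x)=\sum_{k\ge1}\left(\Big(\frac{1}{x+2^k}\Big)^{s} f\Big(\frac{x}{x+2^k}\Big)+\Big(\frac{1}{1+2^kx}\Big)^{s} f\Big(\frac{1}{1+2^kx}\Big)\right). \] *)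

theory Defs
  imports "HOL-Analysis.Complex_Transcendental" "HOL-Analysis.Infinite_Sum"
begin

text \<open>
  Functions on the half-open unit interval are modelled as total functions on the reals.  For
  arguments \<open>x\<close> in that interval the operators below only evaluate \<open>f\<close> at points of it,
  so the values of \<open>f\<close> elsewhere are irrelevant.  All bases of powers are positive reals,
  for which \<open>of_real y powr s\<close> is \<open>exp (s * of_real (ln y))\<close>.
\<close>

definition odd_below :: "nat \<Rightarrow> nat set" where
  "odd_below n = {a. odd a \<and> 0 < a \<and> a < n}"

definition V_term :: "complex \<Rightarrow> (real \<Rightarrow> complex) \<Rightarrow> real \<Rightarrow> nat \<Rightarrow> nat \<Rightarrow> complex" where
  "V_term s f x k a =
     complex_of_real (1 / (real a + 2 ^ k * x)) powr s * f (1 / (real a + 2 ^ k * x))"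

definition U_term :: "complex \<Rightarrow> (real \<Rightarrow> complex) \<Rightarrow> real \<Rightarrow> nat \<Rightarrow> complex" where
  "U_term s f x k =
     complex_of_real (1 / (1 + 2 ^ k * x)) powr s * f (1 / (1 + 2 ^ k * x))"

definition Ut_term :: "complex \<Rightarrow> (real \<Rightarrow> complex) \<Rightarrow> real \<Rightarrow> nat \<Rightarrow> complex" where
  "Ut_term s f x k =
     complex_of_real (1 / (x + 2 ^ k)) powr s * f (x / (x + 2 ^ k))"

definition V_op :: "complex \<Rightarrow> (real \<Rightarrow> complex) \<Rightarrow> real \<Rightarrow> complex" where
  "V_op s f x = (\<Sum>\<^sub>\<infinity>k\<in>{1..}. \<Sum>a\<in>odd_below (2 ^ k). V_term s f x k a)"

definition U_op :: "complex \<Rightarrow> (real \<Rightarrow> complex) \<Rightarrow> real \<Rightarrow> complex" where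
  "U_op s f x = (\<Sum>\<^sub>\<infinity>k\<in>{1..}. U_term s f x k)"

definition Ut_op :: "complex \<Rightarrow> (real \<Rightarrow> complex) \<Rightarrow> real \<Rightarrow> complex" where
  "Ut_op s f x = complex_of_real (1 / x) powr s * U_op s f (1 / x)"

definition B_op :: "complex \<Rightarrow> (real \<Rightarrow> complex) \<Rightarrow> real \<Rightarrow> complex" where
  "B_op s f x = U_op s f x + Ut_op s f x"

text \<open>
  Absolute convergence, at every point of the half-open unit interval, of the series defining
  the respective operator.  For \<open>V_op\<close> this refers to the family of all terms, indexed by
  the pairs \<open>(k, a)\<close>, and not merely to the inner finite sums.
\<close>

definition V_abs_conv :: "complex \<Rightarrow> (real \<Rightarrow> complex) \<Rightarrow> bool" where
  "V_abs_conv s f \<longleftrightarrow>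
     (\<forall>x\<in>{0<..1}. (\<lambda>(k, a). V_term s f x k a) abs_summable_on (SIGMA k:{1..}. odd_below (2 ^ k)))"

definition U_abs_conv :: "complex \<Rightarrow> (real \<Rightarrow> complex) \<Rightarrow> bool" where
  "U_abs_conv s f \<longleftrightarrow> (\<forall>x\<in>{0<..1}. U_term s f x abs_summable_on {1..})"

definition Ut_abs_conv :: "complex \<Rightarrow> (real \<Rightarrow> complex) \<Rightarrow> bool" where
  "Ut_abs_conv s f \<longleftrightarrow> (\<forall>x\<in>{0<..1}. Ut_term s f x abs_summable_on {1..})"

lemma Ut_term_eq:
  assumes "x > 0"
  shows "complex_of_real (1 / x) powr s * U_term s f (1 / x) k = Ut_term s f x k"
proof -
  have eq: "1 / (1 + 2 ^ k * (1 / x)) = x / (x + 2 ^ k)"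
    using assms by (simp add: field_simps)
  have pos: "x + 2 ^ k > 0"
    using assms by (simp add: add_pos_pos)
  have "complex_of_real (1 / x) powr s * complex_of_real (x / (x + 2 ^ k)) powr s
      = (complex_of_real (1 / x) * complex_of_real (x / (x + 2 ^ k))) powr s"
    using assms pos by (intro powr_times_real [symmetric]) auto
  also have "complex_of_real (1 / x) * complex_of_real (x / (x + 2 ^ k))
      = complex_of_real (1 / (x + 2 ^ k))"
    using assms pos by (simp flip: of_real_mult)
  finally show ?thesis
    unfolding U_term_def Ut_term_def eq by (simp only: mult.assoc [symmetric])
qed

lemma Ut_op_series:
  assumes "x > 0"
  shows "Ut_op s f x = (\<Sum>\<^sub>\<infinity>k\<in>{1..}. Ut_term s f x k)"
  unfolding Ut_op_def U_op_def
  by (simp only: infsum_cmult_right' [symmetric] Ut_term_eq [OF assms])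

lemma B_op_series:
  assumes "U_abs_conv s f" "Ut_abs_conv s f" "x \<in> {0<..1}"
  shows "B_op s f x = (\<Sum>\<^sub>\<infinity>k\<in>{1..}. Ut_term s f x k + U_term s f x k)"
proof -
  have "U_term s f x summable_on {1..}" "Ut_term s f x summable_on {1..}"
    using assms unfolding U_abs_conv_def Ut_abs_conv_def
    by (auto intro: abs_summable_summable)
  then show ?thesis
    using assms(3) by (simp add: B_op_def U_op_def Ut_op_series infsum_add add.commute)
qed

end

theory Submission
  imports Defs
begin

text \<open>
  The theorem reduces by linearity to \<open>V f = U f + V (Ut f)\<close>.  The terms of \<open>V f\<close> with
  \<open>a = 1\<close> make up \<open>U f\<close>.  Every odd \<open>b > 1\<close> with \<open>b < 2 ^ m\<close> is uniquely of the form
  \<open>b = 1 + 2 ^ j * a\<close> with \<open>j \<ge> 1\<close>, \<open>a\<close> odd and \<open>a < 2 ^ (m - j)\<close>, and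
  \<open>b + 2 ^ m * x = 1 + 2 ^ j * (a + 2 ^ (m - j) * x)\<close>; so the other terms of \<open>V f\<close> are a
  rearrangement of those of \<open>V (Ut f)\<close>, which converges absolutely because \<open>V f\<close> does.
\<close>

abbreviation V_index :: "(nat \<times> nat) set" where
  "V_index \<equiv> SIGMA k:{1..}. odd_below (2 ^ k)"

lemma finite_odd_below: "finite (odd_below n)"
  by (rule finite_subset[of _ "{..<n}"]) (auto simp: odd_below_def)

lemma V_summable:
  assumes "V_abs_conv s f" "x \<in> {0<..1}"
  shows "(\<lambda>(k, a). V_term s f x k a) summable_on V_index"
  using assms unfolding V_abs_conv_def by (blast intro: abs_summable_summable)

text \<open>Passes from the iterated sum in the definition to an unordered sum over pairs. Only in
  the latter form can the terms be split and reindexed freely.\<close>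

lemma V_op_eq_infsum_pairs:
  assumes "V_abs_conv s f" "x \<in> {0<..1}"
  shows "V_op s f x = (\<Sum>\<^sub>\<infinity>(k, a)\<in>V_index. V_term s f x k a)"
  using infsum_Sigma'_banach[OF V_summable[OF assms]]
  by (simp add: V_op_def infsum_finite finite_odd_below)

lemma has_sum_diff:
  fixes f g :: "'a \<Rightarrow> 'b :: topological_ab_group_add"
  assumes "(f has_sum a) A" "(g has_sum b) A"
  shows "((\<lambda>x. f x - g x) has_sum (a - b)) A"
  using has_sum_add[OF assms(1), of "\<lambda>x. - g x" "- b"] assms(2) by (simp add: has_sum_uminus)

lemma V_term_diff: "V_term s (f - g) x k a = V_term s f x k a - V_term s g x k a"
  by (simp add: V_term_def algebra_simps)

text \<open>For complex families, summability and absolute summability coincide, so subtracting the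
  two sums suffices.\<close>

lemma V_abs_conv_diff:
  assumes "V_abs_conv s f" "V_abs_conv s g"
  shows "V_abs_conv s (f - g)"
  unfolding V_abs_conv_def
proof
  fix x :: real assume x: "x \<in> {0<..1}"
  have "(\<lambda>p. (\<lambda>(k, a). V_term s f x k a) p - (\<lambda>(k, a). V_term s g x k a) p) summable_on V_index"
    using has_sum_diff[OF has_sum_infsum[OF V_summable[OF assms(1) x]]
        has_sum_infsum[OF V_summable[OF assms(2) x]]]
    by (rule has_sum_imp_summable)
  then show "(\<lambda>(k, a). V_term s (f - g) x k a) abs_summable_on V_index"
    by (simp add: V_term_diff case_prod_unfold summable_on_iff_abs_summable_on_complex)
qed

lemma V_op_diff:
  assumes "V_abs_conv s f" "V_abs_conv s g" "x \<in> {0<..1}"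
  shows "V_op s (f - g) x = V_op s f x - V_op s g x"
  using infsumI[OF has_sum_diff[OF has_sum_infsum[OF V_summable[OF assms(1,3)]]
        has_sum_infsum[OF V_summable[OF assms(2,3)]]]]
    V_op_eq_infsum_pairs[OF V_abs_conv_diff[OF assms(1,2)] assms(3)]
  by (simp add: V_op_eq_infsum_pairs[OF assms(1,3)] V_op_eq_infsum_pairs[OF assms(2,3)]
      V_term_diff case_prod_unfold)

text \<open>With \<open>z = a + 2 ^ k * x\<close>, the weight \<open>(1 / z) powr s\<close> of the
  term cancels the factor \<open>z powr s\<close> that \<open>Ut_op\<close> produces at the point
  \<open>1 / z\<close>. What remains is the series of \<open>U_op s f\<close> at
  \<open>z\<close>.\<close>

lemma V_term_Ut_op:
  assumes "x > 0"
  shows "V_term s (Ut_op s f) x k a = (\<Sum>\<^sub>\<infinity>j\<in>{1..}. V_term s f x (j + k) (1 + 2 ^ j * a))"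
proof -
  define z where "z = real a + 2 ^ k * x"
  have z: "z > 0"
    using assms by (simp add: z_def add_nonneg_pos)
  have "complex_of_real (1 / z) powr s * complex_of_real z powr s
      = (complex_of_real (1 / z) * complex_of_real z) powr s"
    using z by (intro powr_times_real [symmetric]) auto
  also have "\<dots> = 1"
    using z by simp
  finally have eq: "V_term s (Ut_op s f) x k a = U_op s f z"
    unfolding V_term_def Ut_op_def z_def [symmetric] by (simp add: mult.assoc [symmetric])
  have "U_term s f z j = V_term s f x (j + k) (1 + 2 ^ j * a)" for j
  proof -
    have "1 + 2 ^ j * z = real (1 + 2 ^ j * a) + 2 ^ (j + k) * x"
      by (simp add: z_def algebra_simps power_add)
    then show ?thesis
      by (simp only: U_term_def V_term_def)
  qed
  then have "U_op s f z = (\<Sum>\<^sub>\<infinity>j\<in>{1..}. V_term s f x (j + k) (1 + 2 ^ j * a))"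
    by (simp only: U_op_def)
  then show ?thesis
    by (simp only: eq)
qed

text \<open>Both exponents are the 2-adic valuation of the common value; unequal ones would make one
  of the odd factors even.\<close>

lemma two_power_mult_odd_unique:
  fixes a b :: nat
  assumes "2 ^ i * a = 2 ^ j * b" "odd a" "odd b"
  shows "i = j"
proof (rule ccontr)
  assume "i \<noteq> j"
  then consider "i < j" | "j < i" by linarith
  then show False
  proof cases
    case 1
    then have "2 ^ j = 2 ^ i * (2::nat) ^ (j - i)" by (simp flip: power_add)
    with assms have "a = 2 ^ (j - i) * b" by simp
    with 1 assms show False by simp
  next
    case 2
    then have "2 ^ i = 2 ^ j * (2::nat) ^ (i - j)" by (simp flip: power_add)
    with assms have "b = 2 ^ (i - j) * a" by simp
    with 2 assms show False by simp
  qed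
qed

lemma two_power_mult_odd_exists:
  fixes n :: nat
  assumes "n > 0"
  shows "\<exists>j a. n = 2 ^ j * a \<and> odd a"
  using assms
proof (induction n rule: less_induct)
  case (less n)
  show ?case
  proof (cases "even n")
    case True
    then obtain m where m: "n = 2 * m" by blast
    have "m < n" "m > 0"
      using less.prems m by auto
    then obtain j a where "m = 2 ^ j * a" "odd a"
      using less.IH by blast
    with m show ?thesis by (intro exI[of _ "Suc j"] exI[of _ a]) simp
  next
    case False
    then show ?thesis by (intro exI[of _ 0] exI[of _ n]) simp
  qed
qed

lemma bij_betw_V_index:
  "bij_betw (\<lambda>((k, a), j). (j + k, 1 + 2 ^ j * a))
     (V_index \<times> {1..}) (V_index - (\<lambda>k. (k, 1)) ` {1..})"
  unfolding bij_betw_def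
proof
  show "inj_on (\<lambda>((k, a), j). (j + k, 1 + 2 ^ j * a :: nat)) (V_index \<times> {1..})"
  proof (rule inj_onI)
    fix p q :: "(nat \<times> nat) \<times> nat"
    assume pq: "p \<in> V_index \<times> {1..}" "q \<in> V_index \<times> {1..}"
      "(\<lambda>((k, a), j). (j + k, 1 + 2 ^ j * a)) p = (\<lambda>((k, a), j). (j + k, 1 + 2 ^ j * a)) q"
    obtain k a i l b j where p: "p = ((k, a), i)" and q: "q = ((l, b), j)"
      by (metis surj_pair)
    have a: "a \<in> odd_below (2 ^ k)" and b: "b \<in> odd_below (2 ^ l)"
      and eq: "i + k = j + l" "1 + 2 ^ i * a = 1 + 2 ^ j * b"
      using pq by (simp_all add: p q)
    \<comment> \<open>The exponent is recovered as the 2-adic valuation of the second component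
      minus 1; the other entries then follow by cancellation.\<close>
    have "i = j"
      using a b eq(2) by (intro two_power_mult_odd_unique[of i a j b]) (auto simp: odd_below_def)
    with eq show "p = q"
      by (simp add: p q)
  qed
next
  show "(\<lambda>((k, a), j). (j + k, 1 + 2 ^ j * a)) ` (V_index \<times> {1..})
      = V_index - (\<lambda>k. (k, 1)) ` {1..}" (is "?g ` _ = ?B")
  proof
    show "?g ` (V_index \<times> {1..}) \<subseteq> ?B"
    proof (rule image_subsetI)
      fix p :: "(nat \<times> nat) \<times> nat"
      assume p_in: "p \<in> V_index \<times> {1..}"
      obtain k a j where p: "p = ((k, a), j)"
        by (metis surj_pair)
      have k: "k \<in> {1..}" and a: "a \<in> odd_below (2 ^ k)" and j: "j \<in> {1..}"
        using p_in by (simp_all add: p)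
      have odd: "odd (1 + 2 ^ j * a)" and ne: "1 + 2 ^ j * a \<noteq> 1"
        using a j by (auto simp: odd_below_def)
      have "2 ^ j * a < 2 ^ (j + k)"
        using a by (simp add: odd_below_def power_add)
      \<comment> \<open>Adding 1 could at worst reach the bound \<open>2 ^ (j + k)\<close> itself;
        parity excludes this.\<close>
      moreover have "even ((2::nat) ^ (j + k))"
        using k by simp
      ultimately have "1 + 2 ^ j * a < 2 ^ (j + k)"
        using odd by (metis Suc_eq_plus1_left Suc_lessI)
      then show "?g p \<in> ?B"
        using k ne odd by (auto simp: p odd_below_def)
    qed
  next
    show "?B \<subseteq> ?g ` (V_index \<times> {1..})"
    proof
      fix q :: "nat \<times> nat"
      assume q_in: "q \<in> ?B"
      obtain m b where q: "q = (m, b)"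
        by (metis surj_pair)
      have m: "m \<in> {1..}" and b: "b \<in> odd_below (2 ^ m)"
        and nin: "(m, b) \<notin> (\<lambda>k. (k, 1)) ` {1..}"
        using q_in by (simp_all add: q)
      have "b - 1 > 0"
        using m b nin by (cases "b = 1") (auto simp: odd_below_def)
      then obtain j a where ja: "b - 1 = 2 ^ j * a" "odd a"
        using two_power_mult_odd_exists by blast
      have b_eq: "b = 1 + 2 ^ j * a"
        using ja \<open>b - 1 > 0\<close> by linarith
      \<comment> \<open>For \<open>j = 0\<close> the number \<open>b = 1 + a\<close> would be
        even.\<close>
      have j: "j \<ge> 1"
        using b ja(2) by (cases j) (auto simp: odd_below_def b_eq)
      have a: "a > 0"
        using ja(2) by (rule odd_pos)
      have "2 ^ j * a < 2 ^ m"
        using b by (simp add: odd_below_def b_eq)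
      \<comment> \<open>The aim is \<open>j < m\<close>: it makes \<open>m - j\<close> a genuine
        difference and an admissible first index, at least 1.\<close>
      moreover have "2 ^ j * 1 \<le> 2 ^ j * a"
        using a by (intro mult_le_mono2) simp
      ultimately have "(2::nat) ^ j < 2 ^ m"
        by linarith
      then have "j < m"
        by simp
      then have "(2::nat) ^ m = 2 ^ j * 2 ^ (m - j)"
        by (simp flip: power_add)
      with \<open>2 ^ j * a < 2 ^ m\<close> have "a < 2 ^ (m - j)"
        by simp
      then have "((m - j, a), j) \<in> V_index \<times> {1..}"
        using \<open>j < m\<close> a j ja(2) by (auto simp: odd_below_def)
      moreover have "q = ?g ((m - j, a), j)"
        using \<open>j < m\<close> b_eq by (simp add: q)
      ultimately show "q \<in> ?g ` (V_index \<times> {1..})"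
        by (rule rev_image_eqI)
    qed
  qed
qed

lemma V_op_eq_U_op_plus_V_op_Ut_op:
  assumes f: "V_abs_conv s f" and Ut: "V_abs_conv s (Ut_op s f)" and x: "x \<in> {0<..1}"
  shows "V_op s f x = U_op s f x + V_op s (Ut_op s f) x"
proof -
  let ?h = "\<lambda>(k, a). V_term s f x k a"
  let ?g = "\<lambda>((k, a), j). (j + k, 1 + 2 ^ j * a)"
  let ?A = "(\<lambda>k. (k, 1)) ` {1..}" and ?B = "V_index - (\<lambda>k. (k, 1)) ` {1..}"
  have A: "?A \<subseteq> V_index"
    by (auto simp: odd_below_def simp flip: One_nat_def intro: one_less_power)
  have summable: "?h summable_on ?A" "?h summable_on ?B"
    using V_summable[OF f x] A by (auto intro: summable_on_subset_banach)
  have "V_op s f x = infsum ?h (?A \<union> ?B)"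
    using A by (simp only: V_op_eq_infsum_pairs[OF f x] Un_Diff_cancel Un_absorb1)
  also have "\<dots> = infsum ?h ?A + infsum ?h ?B"
    using summable by (intro infsum_Un_disjoint) auto
  also have "infsum ?h ?A = U_op s f x"
    by (subst infsum_reindex) (auto simp: inj_on_def U_op_def U_term_def V_term_def o_def)
  also have "infsum ?h ?B = (\<Sum>\<^sub>\<infinity>p\<in>V_index \<times> {1..}. ?h (?g p))"
    by (rule infsum_reindex_bij_betw[OF bij_betw_V_index, symmetric])
  also have "\<dots> = (\<Sum>\<^sub>\<infinity>p\<in>V_index. \<Sum>\<^sub>\<infinity>j\<in>{1..}. ?h (?g (p, j)))"
  \<comment> \<open>Iterating the sum needs summability over the product, which the bijection
    carries over from the part of \<open>V f\<close> with second index different from 1.\<close>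
  proof (rule infsum_Sigma_banach[symmetric])
    show "(\<lambda>p. ?h (?g p)) summable_on V_index \<times> {1..}"
      using summable(2) summable_on_reindex_bij_betw[OF bij_betw_V_index, of ?h] by simp
  qed
  also have "\<dots> = (\<Sum>\<^sub>\<infinity>(k, a)\<in>V_index. V_term s (Ut_op s f) x k a)"
    using x by (intro infsum_cong) (auto simp: V_term_Ut_op)
  also have "\<dots> = V_op s (Ut_op s f) x"
    using V_op_eq_infsum_pairs[OF Ut x] by simp
  finally show ?thesis .
qed

theorem theorem1:
  fixes s :: complex and f :: "real \<Rightarrow> complex"
  assumes "U_abs_conv s f" and "Ut_abs_conv s f" and "V_abs_conv s f"
    and "V_abs_conv s (U_op s f)" and "V_abs_conv s (B_op s f)"
  shows "\<forall>x\<in>{0<..1}. ((V_op s - id) \<circ> U_op s) f x = (V_op s \<circ> (B_op s - id)) f x"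
proof
  fix x :: real assume x: "x \<in> {0<..1}"
  \<comment> \<open>Writing \<open>Ut_op s f\<close> as a difference lets it inherit
    \<open>V_abs_conv\<close> from \<open>B_op s f\<close> and \<open>U_op s f\<close>.\<close>
  have Ut: "Ut_op s f = B_op s f - U_op s f"
    by (simp add: fun_eq_iff B_op_def)
  have "V_op s f x = U_op s f x + V_op s (Ut_op s f) x"
    using assms x by (intro V_op_eq_U_op_plus_V_op_Ut_op) (auto simp: Ut intro: V_abs_conv_diff)
  also have "V_op s (Ut_op s f) x = V_op s (B_op s f) x - V_op s (U_op s f) x"
    unfolding Ut by (rule V_op_diff[OF assms(5,4) x])
  \<comment> \<open>The chain gives \<open>V f = U f + V (B f) - V (U f)\<close>, which rearranges
    to \<open>V (U f) - U f = V (B f) - V f\<close>.\<close>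
  finally show "((V_op s - id) \<circ> U_op s) f x = (V_op s \<circ> (B_op s - id)) f x"
    by (simp add: V_op_diff[OF assms(5,3) x])
qed

end
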